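(* Let $D=(V,A)$ be a digraph with minimum dicut size $\tau$, and let $k\geq 2$ be a rational number. If the underlying undirected graph of $D$ admits a nowhere-zero circular $k$-flow, then $D$ contains $\lfloor \tau/k\rfloor$ pairwise arc-disjoint dijoins.
   Context: All graphs and digraphs are finite and loopless; parallel edges/arcs are allowed. For a digraph $D=(V,A)$ and $\emptyset\neq U\subsetneq V$, $\delta^+_D(U)$ (resp. $\delta^-_D(U)$) denotes the set of arcs leaving (resp. entering) $U$. A dicut is an arc set of the form $\delta^+_D(U)$ with $\emptyset\neq U\subsetneq V$ and $\delta^-_D(U)=\emptyset$. A dijoin is an arc subset intersecting every dicut. "$D$ has minimum dicut size $\tau$" means $D$ has at least one dicut and the minimum number of arcs in a dicut is $\tau$. The underlying undirected graph of $D$ is obtained by replacing each arc $(u,v)$ by an edge $\{u,v\}$. For an undirected graph $G=(V,E)$ and a rational $k\ge 2$, a nowhere-zero circular $k$-flow of $G$ is a pair $(E^+,f)$ where $E^+$ is an orientation of $G$ (each edge directed in one of its two directions) and $f:E^+\to[1,k-1]$ is real-valued with $\sum_{a\in E^+\text{ leaving } v} f(a)=\sum_{a\in E^+\text{ entering } v} f(a)$ for every vertex $v$. *)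

theory Defs
  imports Complex_Main
begin

text \<open>A digraph D = (V, A) with parallel arcs allowed: arcs are elements of an
index set A, each arc a has tail tail a and head head a.\<close>

definition digraph :: "'v set \<Rightarrow> 'a set \<Rightarrow> ('a \<Rightarrow> 'v) \<Rightarrow> ('a \<Rightarrow> 'v) \<Rightarrow> bool" where
  "digraph V A tail head \<longleftrightarrow> finite V \<and> finite A \<and>
     (\<forall>a\<in>A. tail a \<in> V \<and> head a \<in> V \<and> tail a \<noteq> head a)"

definition out_arcs :: "'a set \<Rightarrow> ('a \<Rightarrow> 'v) \<Rightarrow> ('a \<Rightarrow> 'v) \<Rightarrow> 'v set \<Rightarrow> 'a set" where
  "out_arcs A tail head U = {a\<in>A. tail a \<in> U \<and> head a \<notin> U}"

definition in_arcs :: "'a set \<Rightarrow> ('a \<Rightarrow> 'v) \<Rightarrow> ('a \<Rightarrow> 'v) \<Rightarrow> 'v set \<Rightarrow> 'a set" where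
  "in_arcs A tail head U = {a\<in>A. head a \<in> U \<and> tail a \<notin> U}"

definition is_dicut :: "'v set \<Rightarrow> 'a set \<Rightarrow> ('a \<Rightarrow> 'v) \<Rightarrow> ('a \<Rightarrow> 'v) \<Rightarrow> 'a set \<Rightarrow> bool" where
  "is_dicut V A tail head C \<longleftrightarrow> (\<exists>U. U \<noteq> {} \<and> U \<subset> V \<and> in_arcs A tail head U = {} \<and>
       C = out_arcs A tail head U)"

definition is_dijoin :: "'v set \<Rightarrow> 'a set \<Rightarrow> ('a \<Rightarrow> 'v) \<Rightarrow> ('a \<Rightarrow> 'v) \<Rightarrow> 'a set \<Rightarrow> bool" where
  "is_dijoin V A tail head J \<longleftrightarrow> J \<subseteq> A \<and> (\<forall>C. is_dicut V A tail head C \<longrightarrow> J \<inter> C \<noteq> {})"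

definition min_dicut_size :: "'v set \<Rightarrow> 'a set \<Rightarrow> ('a \<Rightarrow> 'v) \<Rightarrow> ('a \<Rightarrow> 'v) \<Rightarrow> nat \<Rightarrow> bool" where
  "min_dicut_size V A tail head \<tau> \<longleftrightarrow> (\<exists>C. is_dicut V A tail head C) \<and>
     \<tau> = Min {card C | C. is_dicut V A tail head C}"

text \<open>Nowhere-zero circular k-flow of the underlying undirected graph: the edge of
arc a is oriented as a if fwd a, and reversed otherwise; f a is its flow value.\<close>
definition nz_circular_flow :: "'v set \<Rightarrow> 'a set \<Rightarrow> ('a \<Rightarrow> 'v) \<Rightarrow> ('a \<Rightarrow> 'v) \<Rightarrow> real \<Rightarrow>
     ('a \<Rightarrow> bool) \<Rightarrow> ('a \<Rightarrow> real) \<Rightarrow> bool" where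
  "nz_circular_flow V A tail head k fwd f \<longleftrightarrow>
     (\<forall>a\<in>A. 1 \<le> f a \<and> f a \<le> k - 1) \<and>
     (\<forall>v\<in>V. (\<Sum>a\<in>{a\<in>A. (if fwd a then tail a else head a) = v}. f a) =
             (\<Sum>a\<in>{a\<in>A. (if fwd a then head a else tail a) = v}. f a))"

definition has_nz_circular_flow :: "'v set \<Rightarrow> 'a set \<Rightarrow> ('a \<Rightarrow> 'v) \<Rightarrow> ('a \<Rightarrow> 'v) \<Rightarrow> real \<Rightarrow> bool" where
  "has_nz_circular_flow V A tail head k \<longleftrightarrow> (\<exists>fwd f. nz_circular_flow V A tail head k fwd f)"

end

theory Submission
  imports Defs "HOL-Library.Disjoint_Sets"
begin

text \<open>A nowhere-zero circular \<open>k\<close>-flow orients the underlying graph so that at least a fraction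
  \<open>1/k\<close> of every cut points in each direction. Hence the arcs \<open>P\<close> that keep their orientation, and
  the arcs \<open>N\<close> that are reversed, each have at least \<open>\<tau>/k\<close> elements in every dicut. Fix a vertex
  \<open>r\<close>. The shores avoiding \<open>r\<close> of dicuts form a family closed under unions and nonempty
  intersections, so \<open>P\<close> splits into \<open>\<lfloor>\<tau>/k\<rfloor>\<close> disjoint sets each meeting all dicuts \<open>\<delta>\<^sup>+(U)\<close> with
  \<open>r \<notin> U\<close>, by the argument of Lovasz for Edmonds' disjoint arborescences theorem; likewise \<open>N\<close>
  splits into sets meeting all dicuts with \<open>r \<in> U\<close>. Pairing these sets up gives the dijoins.\<close>

section \<open>Packing disjoint covers of a union-closed set family\<close>

lemma finite_in_arcs: "finite B \<Longrightarrow> finite (in_arcs B src dst U)"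
  unfolding in_arcs_def by simp

lemma in_arcs_empty: "in_arcs B src dst U = {} \<longleftrightarrow> (\<forall>a\<in>B. dst a \<in> U \<longrightarrow> src a \<in> U)"
  unfolding in_arcs_def by auto

text \<open>An arc entering \<open>U \<inter> W\<close> or \<open>U \<union> W\<close> enters
  \<open>U\<close> or \<open>W\<close>, and an arc entering both of the former enters both of the
  latter.\<close>

lemma card_in_arcs_submodular:
  assumes "finite B"
  shows "card (in_arcs B src dst (U \<inter> W)) + card (in_arcs B src dst (U \<union> W))
    \<le> card (in_arcs B src dst U) + card (in_arcs B src dst W)"
proof -
  let ?d = "in_arcs B src dst"
  note fin = finite_in_arcs[OF assms, of src dst]
  have "card (?d (U \<inter> W)) + card (?d (U \<union> W))
      = card (?d (U \<inter> W) \<union> ?d (U \<union> W)) + card (?d (U \<inter> W) \<inter> ?d (U \<union> W))"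
    using card_Un_Int[OF fin fin] .
  also have "\<dots> \<le> card (?d U \<union> ?d W) + card (?d U \<inter> ?d W)"
    by (intro add_mono card_mono finite_UnI finite_Int disjI1 fin) (auto simp: in_arcs_def)
  also have "\<dots> = card (?d U) + card (?d W)"
    using card_Un_Int[OF fin fin] by simp
  finally show ?thesis .
qed

lemma Union_in_family:
  assumes "finite G" "G \<noteq> {}" "G \<subseteq> F" and "\<And>U W. U \<in> F \<Longrightarrow> W \<in> F \<Longrightarrow> U \<union> W \<in> F"
  shows "\<Union>G \<in> F"
  using assms(1-3) by (induction G rule: finite_ne_induct) (auto intro: assms(4))

text \<open>The partial cover \<open>X\<close> is extended by an arc entering \<open>Z\<close>, where \<open>Z\<close> contains all members of
  \<open>F\<close> not yet covered and no head of an arc of \<open>X\<close>. An arc entering \<open>Z\<close> is unsuitable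
  only if it enters a critical set, that is, one entered by exactly \<open>t\<close> of the remaining arcs.\<close>

lemma extend_cover:
  assumes "finite B" and Z: "Z \<in> F" and finF: "finite (\<Union>F)"
    and Int: "\<And>U W. U \<in> F \<Longrightarrow> W \<in> F \<Longrightarrow> U \<inter> W \<noteq> {} \<Longrightarrow> U \<inter> W \<in> F"
    and Un: "\<And>U W. U \<in> F \<Longrightarrow> W \<in> F \<Longrightarrow> U \<union> W \<in> F"
    and large: "\<And>U. U \<in> F \<Longrightarrow> t < card (in_arcs B src dst U)"
    and heads: "\<And>a. a \<in> X \<Longrightarrow> dst a \<notin> Z"
    and rest: "\<And>U. U \<in> F \<Longrightarrow> t \<le> card (in_arcs (B - X) src dst U)"
  obtains e where "e \<in> in_arcs (B - X) src dst Z"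
    "\<And>U. U \<in> F \<Longrightarrow> t \<le> card (in_arcs (B - insert e X) src dst U)"
proof -
  let ?d = "\<lambda>U. in_arcs (B - X) src dst U"
  note fin = finite_in_arcs[OF finite_Diff[OF assms(1)], of X src dst]
  have large': "t < card (?d U)" if "U \<in> F" "U \<subseteq> Z" for U
  proof -
    \<comment> \<open>No arc of \<open>X\<close> has its head in \<open>Z\<close>, so discarding
      \<open>X\<close> costs a subset of \<open>Z\<close> nothing.\<close>
    have "?d U = in_arcs B src dst U" using that(2) heads by (auto simp: in_arcs_def)
    thus ?thesis using large that(1) by simp
  qed
  \<comment> \<open>Only tight sets meeting \<open>Z\<close> matter: the new arc has its head in
    \<open>Z\<close>, so every set it enters meets \<open>Z\<close>.\<close>
  define critical where "critical U \<longleftrightarrow> U \<in> F \<and> U \<inter> Z \<noteq> {} \<and> card (?d U) = t" for U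
  have "\<exists>e \<in> ?d Z. \<forall>U. critical U \<longrightarrow> e \<notin> ?d U"
  proof (cases "\<exists>U. critical U")
    case False
    have "?d Z \<noteq> {}" using large'[OF Z] by auto
    thus ?thesis using False by auto
  next
    case True
    have "finite {U. critical U}"
      by (rule finite_subset[of _ "Pow (\<Union>F)"]) (use finF in \<open>auto simp: critical_def\<close>)
    then obtain U where U: "critical U" and min: "\<And>W. critical W \<Longrightarrow> W \<subseteq> U \<Longrightarrow> W = U"
      using finite_has_minimal[of "{U. critical U}"] True by auto
    \<comment> \<open>\<open>U\<close> has exactly \<open>t\<close> remaining entering arcs, but
      \<open>U \<inter> Z\<close> has more. Some arc therefore enters the intersection without
      entering \<open>U\<close>, so its tail lies in \<open>U - Z\<close>.\<close>
    have "U \<inter> Z \<in> F" using U Z Int by (auto simp: critical_def)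
    hence "card (?d U) < card (?d (U \<inter> Z))" using large' U by (auto simp: critical_def)
    hence "\<not> ?d (U \<inter> Z) \<subseteq> ?d U" using card_mono[OF fin] by (meson leD)
    then obtain e where e: "e \<in> ?d (U \<inter> Z)" "e \<notin> ?d U" by blast
    hence src: "src e \<in> U" "src e \<notin> Z" and dst: "dst e \<in> U" "dst e \<in> Z" and "e \<in> ?d Z"
      by (auto simp: in_arcs_def)
    moreover have "e \<notin> ?d W" if W: "critical W" for W
    proof
      assume "e \<in> ?d W"
      hence *: "dst e \<in> W" "src e \<notin> W" by (auto simp: in_arcs_def)
      have "U \<inter> W \<in> F" "U \<union> W \<in> F"
        using U W dst * Int Un by (auto simp: critical_def)
      \<comment> \<open>Uncrossing: \<open>U\<close> and \<open>W\<close> have \<open>t\<close>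
        entering arcs each, their intersection and union at least \<open>t\<close> each, so
        submodularity forces equality. Minimality then gives \<open>U \<subseteq> W\<close>,
        although the tail of \<open>e\<close> lies in \<open>U - W\<close>.\<close>
      hence "critical (U \<inter> W)"
        using card_in_arcs_submodular[OF finite_Diff[OF assms(1)], of X src dst U W]
          rest[of "U \<inter> W"] rest[of "U \<union> W"] U W dst * unfolding critical_def by auto
      thus False using min[of "U \<inter> W"] src * by auto
    qed
    ultimately show ?thesis by blast
  qed
  then obtain e where e: "e \<in> ?d Z" and not_crit: "\<And>U. critical U \<Longrightarrow> e \<notin> ?d U" by blast
  have "t \<le> card (in_arcs (B - insert e X) src dst U)" if U: "U \<in> F" for U
  proof -
    have eq: "in_arcs (B - insert e X) src dst U = ?d U - {e}" by (auto simp: in_arcs_def)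
    show ?thesis
    proof (cases "e \<in> ?d U")
      case True
      hence "card (?d U) \<noteq> t" using e not_crit[of U] U by (auto simp: critical_def in_arcs_def)
      thus ?thesis using rest[OF U] True eq fin by (simp add: card_Diff_singleton)
    next
      case False
      thus ?thesis using rest[OF U] eq by simp
    qed
  qed
  with e that show ?thesis by blast
qed

text \<open>This peels off a single cover. It is grown arc by arc inside a shrinking set
  \<open>Z\<close> that contains every uncovered member and no head of a chosen arc.\<close>

lemma cover_leaving_rest:
  assumes "finite B" and finF: "finite (\<Union>F)"
    and Int: "\<And>U W. U \<in> F \<Longrightarrow> W \<in> F \<Longrightarrow> U \<inter> W \<noteq> {} \<Longrightarrow> U \<inter> W \<in> F"
    and Un: "\<And>U W. U \<in> F \<Longrightarrow> W \<in> F \<Longrightarrow> U \<union> W \<in> F"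
    and large: "\<And>U. U \<in> F \<Longrightarrow> t < card (in_arcs B src dst U)"
  obtains X where "X \<subseteq> B" "\<And>U. U \<in> F \<Longrightarrow> in_arcs X src dst U \<noteq> {}"
    "\<And>U. U \<in> F \<Longrightarrow> t \<le> card (in_arcs (B - X) src dst U)"
proof -
  have "\<exists>Y\<subseteq>B. \<forall>U\<in>F. in_arcs Y src dst U \<noteq> {} \<and> t \<le> card (in_arcs (B - Y) src dst U)"
    if "finite Z" "X \<subseteq> B" "\<forall>U\<in>F. in_arcs X src dst U = {} \<longrightarrow> U \<subseteq> Z" "\<forall>a\<in>X. dst a \<notin> Z"
      "\<forall>U\<in>F. t \<le> card (in_arcs (B - X) src dst U)" for X Z
    using that
  proof (induction Z arbitrary: X rule: finite_psubset_induct)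
    case (psubset Z)
    show ?case
    proof (cases "\<exists>U\<in>F. U \<subseteq> Z")
      case False
      thus ?thesis using psubset.prems by blast
    next
      case True
      \<comment> \<open>The largest member inside \<open>Z\<close>; it still contains all uncovered
        members, and being in \<open>F\<close> it can be entered by a new arc.\<close>
      define Z' where "Z' = \<Union>{U\<in>F. U \<subseteq> Z}"
      have "Z' \<in> F" unfolding Z'_def
        by (rule Union_in_family) (use True psubset.hyps Un in auto)
      have "Z' \<subseteq> Z" by (auto simp: Z'_def)
      have heads: "dst a \<notin> Z'" if "a \<in> X" for a
        using that psubset.prems(3) \<open>Z' \<subseteq> Z\<close> by blast
      obtain e where e: "e \<in> in_arcs (B - X) src dst Z'"
        and rest: "\<And>U. U \<in> F \<Longrightarrow> t \<le> card (in_arcs (B - insert e X) src dst U)"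
        using extend_cover[OF assms(1) \<open>Z' \<in> F\<close> finF Int Un large heads psubset.prems(4)[rule_format]]
        by blast
      have uncovered: "U \<subseteq> Z' - {dst e}" if U: "U \<in> F" "in_arcs (insert e X) src dst U = {}" for U
      proof -
        have "in_arcs X src dst U = {}" using U(2) by (auto simp: in_arcs_def)
        hence "U \<subseteq> Z'" using U(1) psubset.prems(2) by (auto simp: Z'_def)
        moreover have "dst e \<notin> U" using U(2) e \<open>U \<subseteq> Z'\<close> by (auto simp: in_arcs_def)
        ultimately show ?thesis by blast
      qed
      have sub: "Z' - {dst e} \<subset> Z" "insert e X \<subseteq> B"
        using e \<open>Z' \<subseteq> Z\<close> psubset.prems(1) by (auto simp: in_arcs_def)
      show ?thesis
        by (rule psubset.IH[OF sub]) (use uncovered heads rest in auto)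
    qed
  qed
  from this[of "\<Union>F" "{}"] obtain Y where "Y \<subseteq> B"
    "\<forall>U\<in>F. in_arcs Y src dst U \<noteq> {} \<and> t \<le> card (in_arcs (B - Y) src dst U)"
    using finF large by (auto intro: less_imp_le)
  thus ?thesis using that by blast
qed

text \<open>Induction on \<open>t\<close>: remove one cover so that every member keeps one entering
  arc fewer than demanded, then pack the remaining arcs.\<close>

lemma disjoint_covers:
  assumes "finite B" and finF: "finite (\<Union>F)"
    and Int: "\<And>U W. U \<in> F \<Longrightarrow> W \<in> F \<Longrightarrow> U \<inter> W \<noteq> {} \<Longrightarrow> U \<inter> W \<in> F"
    and Un: "\<And>U W. U \<in> F \<Longrightarrow> W \<in> F \<Longrightarrow> U \<union> W \<in> F"
    and large: "\<And>U. U \<in> F \<Longrightarrow> t \<le> card (in_arcs B src dst U)"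
  obtains J where "\<And>i. i < t \<Longrightarrow> J i \<subseteq> B" "disjoint_family_on J {..<t}"
    "\<And>i U. i < t \<Longrightarrow> U \<in> F \<Longrightarrow> in_arcs (J i) src dst U \<noteq> {}"
proof -
  have "\<exists>J. (\<forall>i<t. J i \<subseteq> B \<and> (\<forall>U\<in>F. in_arcs (J i) src dst U \<noteq> {})) \<and> disjoint_family_on J {..<t}"
    using assms(1) large
  proof (induction t arbitrary: B)
    case 0
    show ?case by (simp add: disjoint_family_on_def)
  next
    case (Suc t)
    obtain X where X: "X \<subseteq> B" "\<And>U. U \<in> F \<Longrightarrow> in_arcs X src dst U \<noteq> {}"
      "\<And>U. U \<in> F \<Longrightarrow> t \<le> card (in_arcs (B - X) src dst U)"
      using cover_leaving_rest[OF Suc.prems(1) finF Int Un, of t src dst] Suc.prems(2)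
      unfolding Suc_le_eq by blast
    have "\<exists>J. (\<forall>i<t. J i \<subseteq> B - X \<and> (\<forall>U\<in>F. in_arcs (J i) src dst U \<noteq> {})) \<and>
        disjoint_family_on J {..<t}"
      by (rule Suc.IH) (use Suc.prems(1) X(3) in auto)
    then obtain J where J: "\<forall>i<t. J i \<subseteq> B - X \<and> (\<forall>U\<in>F. in_arcs (J i) src dst U \<noteq> {})"
        "disjoint_family_on J {..<t}" by blast
    have "disjoint_family_on (J(t := X)) {..<Suc t}"
    proof -
      have "disjoint_family_on (J(t := X)) {..<t}"
        using J(2) by (simp add: disjoint_family_on_def)
      moreover have "X \<inter> (\<Union>i<t. (J(t := X)) i) = {}" using J(1) by fastforce
      ultimately show ?thesis by (simp add: lessThan_Suc disjoint_family_on_insert)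
    qed
    moreover have "\<forall>i<Suc t. (J(t := X)) i \<subseteq> B \<and> (\<forall>U\<in>F. in_arcs ((J(t := X)) i) src dst U \<noteq> {})"
      using J(1) X by (auto simp: less_Suc_eq)
    ultimately show ?case by blast
  qed
  thus ?thesis using that by blast
qed

section \<open>Flow across a cut and balance of dicuts\<close>

lemma flow_conservation_cut:
  fixes f :: "'a \<Rightarrow> 'b :: ab_group_add"
  assumes "finite A" "finite U"
    and cons: "\<And>v. v \<in> U \<Longrightarrow> (\<Sum>a\<in>{a\<in>A. src a = v}. f a) = (\<Sum>a\<in>{a\<in>A. dst a = v}. f a)"
  shows "sum f (out_arcs A src dst U) = sum f (in_arcs A src dst U)"
proof -
  have fibres: "sum f {a\<in>A. g a \<in> U} = (\<Sum>v\<in>U. \<Sum>a\<in>{a\<in>A. g a = v}. f a)" for g :: "'a \<Rightarrow> 'c"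
  proof -
    have "(\<Sum>v\<in>U. sum f {a \<in> {a\<in>A. g a \<in> U}. g a = v}) = sum f {a\<in>A. g a \<in> U}"
      by (rule sum.group) (use assms in auto)
    moreover have "{a \<in> {a\<in>A. g a \<in> U}. g a = v} = {a\<in>A. g a = v}" if "v \<in> U" for v
      using that by auto
    ultimately show ?thesis by simp
  qed
  \<comment> \<open>Arcs inside \<open>U\<close> contribute equally to both sides of the summed
    conservation law and cancel.\<close>
  let ?I = "{a\<in>A. src a \<in> U \<and> dst a \<in> U}"
  have split: "sum f (S \<union> ?I) = sum f S + sum f ?I" if "S \<subseteq> A" "S \<inter> ?I = {}" for S
    using that assms(1) by (intro sum.union_disjoint) (auto intro: finite_subset)
  have part: "out_arcs A src dst U \<subseteq> A" "out_arcs A src dst U \<inter> ?I = {}"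
    "in_arcs A src dst U \<subseteq> A" "in_arcs A src dst U \<inter> ?I = {}"
    by (auto simp: out_arcs_def in_arcs_def)
  have "{a\<in>A. src a \<in> U} = out_arcs A src dst U \<union> ?I" "{a\<in>A. dst a \<in> U} = in_arcs A src dst U \<union> ?I"
    by (auto simp: out_arcs_def in_arcs_def)
  moreover have "sum f {a\<in>A. src a \<in> U} = sum f {a\<in>A. dst a \<in> U}"
    using cons by (simp add: fibres)
  ultimately have "sum f (out_arcs A src dst U) + sum f ?I = sum f (in_arcs A src dst U) + sum f ?I"
    using split[OF part(1,2)] split[OF part(3,4)] by simp
  thus ?thesis by simp
qed

text \<open>The common flow value is at least \<open>card P\<close> and at most
  \<open>(k - 1) * card N\<close>.\<close>

lemma card_le_of_equal_flow:
  fixes k :: real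
  assumes "finite P" "finite N" "sum f P = sum f N"
    and "\<And>a. a \<in> P \<union> N \<Longrightarrow> 1 \<le> f a \<and> f a \<le> k - 1"
  shows "real (card P + card N) \<le> k * card N"
proof -
  have "real (card P) \<le> sum f P" using sum_mono[of P "\<lambda>_. 1" f] assms by simp
  also have "\<dots> \<le> (k - 1) * card N"
    using sum_mono[of N f "\<lambda>_. k - 1"] assms by (simp add: mult.commute)
  finally show ?thesis by (simp add: algebra_simps)
qed

text \<open>All arcs of \<open>C\<close> leave \<open>U\<close> in the digraph, so in the
  orientation of the flow the kept ones leave \<open>U\<close> and the reversed ones enter it.
  Conservation gives both classes the same total flow.\<close>

lemma dicut_balanced:
  assumes D: "digraph V A tail head"
    and flow: "nz_circular_flow V A tail head k fwd f"
    and U: "U \<subseteq> V" "in_arcs A tail head U = {}"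
  defines "C \<equiv> out_arcs A tail head U"
  shows "real (card C) \<le> k * card {a\<in>C. fwd a}" "real (card C) \<le> k * card {a\<in>C. \<not> fwd a}"
proof -
  let ?tl = "\<lambda>a. if fwd a then tail a else head a"
  let ?hd = "\<lambda>a. if fwd a then head a else tail a"
  have fin: "finite A" "finite U" "finite C"
    using D U(1) by (auto simp: digraph_def C_def out_arcs_def intro: finite_subset)
  have "out_arcs A ?tl ?hd U = {a\<in>C. fwd a}" "in_arcs A ?tl ?hd U = {a\<in>C. \<not> fwd a}"
    using U(2) by (auto simp: C_def out_arcs_def in_arcs_def)
  moreover have "sum f (out_arcs A ?tl ?hd U) = sum f (in_arcs A ?tl ?hd U)"
  proof (rule flow_conservation_cut[OF fin(1,2)])
    fix v assume "v \<in> U"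
    thus "sum f {a\<in>A. ?tl a = v} = sum f {a\<in>A. ?hd a = v}"
      using flow U(1) unfolding nz_circular_flow_def by blast
  qed
  ultimately have eq: "sum f {a\<in>C. fwd a} = sum f {a\<in>C. \<not> fwd a}" by simp
  have "{a\<in>C. fwd a} \<union> {a\<in>C. \<not> fwd a} = C" "{a\<in>C. fwd a} \<inter> {a\<in>C. \<not> fwd a} = {}" by auto
  hence card: "card {a\<in>C. fwd a} + card {a\<in>C. \<not> fwd a} = card C"
    using card_Un_disjoint[of "{a\<in>C. fwd a}" "{a\<in>C. \<not> fwd a}"] fin(3) by simp
  have bounds: "1 \<le> f a \<and> f a \<le> k - 1" if "a \<in> C" for a
    using that flow by (auto simp: nz_circular_flow_def C_def out_arcs_def)
  show "real (card C) \<le> k * card {a\<in>C. \<not> fwd a}"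
    using card_le_of_equal_flow[of "{a\<in>C. fwd a}" "{a\<in>C. \<not> fwd a}" f k] fin(3) eq bounds card
    by auto
  show "real (card C) \<le> k * card {a\<in>C. fwd a}"
    using card_le_of_equal_flow[of "{a\<in>C. \<not> fwd a}" "{a\<in>C. fwd a}" f k] fin(3) eq bounds card
    by (auto simp: add.commute)
qed

section \<open>From balanced dicuts to disjoint dijoins\<close>

lemma min_dicut_size_le:
  assumes "digraph V A tail head" "min_dicut_size V A tail head \<tau>" "is_dicut V A tail head C"
  shows "\<tau> \<le> card C"
proof -
  have sub: "C \<subseteq> A" if "is_dicut V A tail head C" for C
    using that by (auto simp: is_dicut_def out_arcs_def)
  have "finite {C. is_dicut V A tail head C}"
    by (rule finite_subset[of _ "Pow A"]) (use assms(1) sub in \<open>auto simp: digraph_def\<close>)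
  hence "finite {card C | C. is_dicut V A tail head C}" by simp
  moreover have "card C \<in> {card C | C. is_dicut V A tail head C}" using assms(3) by blast
  ultimately show ?thesis using assms(2) by (simp add: min_dicut_size_def)
qed

text \<open>Dicuts \<open>\<delta>\<^sup>+(U)\<close> with \<open>r \<notin> U\<close> are met by arcs of \<open>P\<close> and those with \<open>r \<in> U\<close> by arcs of
  \<open>N\<close>. In the first case the roles of tail and head are exchanged, in the second case the
  family consists of the complements \<open>V - U\<close>.\<close>

lemma dijoins_from_two_classes:
  assumes D: "digraph V A tail head" and PN: "P \<subseteq> A" "N \<subseteq> A" "P \<inter> N = {}"
    and large: "\<And>C. is_dicut V A tail head C \<Longrightarrow> t \<le> card (C \<inter> P) \<and> t \<le> card (C \<inter> N)"
  obtains J where "\<And>i. i < t \<Longrightarrow> is_dijoin V A tail head (J i)" "disjoint_family_on J {..<t}"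
proof -
  have finV: "finite V" and ends: "\<And>a. a \<in> A \<Longrightarrow> tail a \<in> V \<and> head a \<in> V"
    and fin: "finite P" "finite N"
    using D PN by (auto simp: digraph_def intro: finite_subset)
  \<comment> \<open>Keeping \<open>r\<close> out of all members keeps unions proper subsets of
    \<open>V\<close>, so both families are closed under union. For empty \<open>V\<close> the vertex
    is arbitrary and both families are empty.\<close>
  obtain r where r: "V \<noteq> {} \<Longrightarrow> r \<in> V" by blast
  define F where "F = {U. U \<noteq> {} \<and> U \<subseteq> V - {r} \<and> in_arcs A tail head U = {}}"
  define G where "G = {U. U \<noteq> {} \<and> U \<subseteq> V - {r} \<and> in_arcs A head tail U = {}}"
  have "t \<le> card (in_arcs P head tail U)" if "U \<in> F" for U
  proof -
    have "is_dicut V A tail head (out_arcs A tail head U)"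
      using that r unfolding is_dicut_def F_def by blast
    moreover have "in_arcs P head tail U = out_arcs A tail head U \<inter> P"
      using PN(1) by (auto simp: in_arcs_def out_arcs_def)
    ultimately show ?thesis using large by simp
  qed
  moreover have finF: "finite (\<Union>F)"
    by (rule finite_subset[OF _ finV]) (auto simp: F_def)
  moreover have famF: "\<And>U W. U \<in> F \<Longrightarrow> W \<in> F \<Longrightarrow> U \<inter> W \<noteq> {} \<Longrightarrow> U \<inter> W \<in> F"
    "\<And>U W. U \<in> F \<Longrightarrow> W \<in> F \<Longrightarrow> U \<union> W \<in> F"
    unfolding F_def in_arcs_empty by blast+
  ultimately obtain X where X: "\<And>i. i < t \<Longrightarrow> X i \<subseteq> P" "disjoint_family_on X {..<t}"
    "\<And>i U. i < t \<Longrightarrow> U \<in> F \<Longrightarrow> in_arcs (X i) head tail U \<noteq> {}"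
    using disjoint_covers[OF fin(1) finF famF, of t head tail] by blast
  have "t \<le> card (in_arcs N tail head U)" if U: "U \<in> G" for U
  proof -
    have "V - U \<noteq> {} \<and> V - U \<subset> V \<and> in_arcs A tail head (V - U) = {}"
      using U r ends unfolding G_def in_arcs_def by blast
    hence "is_dicut V A tail head (out_arcs A tail head (V - U))"
      unfolding is_dicut_def by (intro exI[of _ "V - U"]) simp
    moreover have "in_arcs N tail head U = out_arcs A tail head (V - U) \<inter> N"
      using PN(2) U ends by (auto simp: in_arcs_def out_arcs_def G_def)
    ultimately show ?thesis using large by simp
  qed
  moreover have finG: "finite (\<Union>G)"
    by (rule finite_subset[OF _ finV]) (auto simp: G_def)
  moreover have famG: "\<And>U W. U \<in> G \<Longrightarrow> W \<in> G \<Longrightarrow> U \<inter> W \<noteq> {} \<Longrightarrow> U \<inter> W \<in> G"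
    "\<And>U W. U \<in> G \<Longrightarrow> W \<in> G \<Longrightarrow> U \<union> W \<in> G"
    unfolding G_def in_arcs_empty by blast+
  ultimately obtain Y where Y: "\<And>i. i < t \<Longrightarrow> Y i \<subseteq> N" "disjoint_family_on Y {..<t}"
    "\<And>i U. i < t \<Longrightarrow> U \<in> G \<Longrightarrow> in_arcs (Y i) tail head U \<noteq> {}"
    using disjoint_covers[OF fin(2) finG famG, of t tail head] by blast
  show ?thesis
  proof
    show "disjoint_family_on (\<lambda>i. X i \<union> Y i) {..<t}"
    proof -
      have "X i \<inter> Y j = {}" if "i < t" "j < t" for i j
        using X(1)[OF that(1)] Y(1)[OF that(2)] PN(3) by blast
      thus ?thesis using X(2) Y(2) unfolding disjoint_family_on_def
        by (simp add: Int_Un_distrib Int_Un_distrib2 Int_commute)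
    qed
    fix i assume i: "i < t"
    have "(X i \<union> Y i) \<inter> C \<noteq> {}" if dicut: "is_dicut V A tail head C" for C
    proof -
      obtain U where U: "U \<noteq> {}" "U \<subset> V" "in_arcs A tail head U = {}"
        and C: "C = out_arcs A tail head U"
        using dicut by (auto simp: is_dicut_def)
      show ?thesis
      proof (cases "r \<in> U")
        case False
        hence "in_arcs (X i) head tail U \<noteq> {}" using U X(3)[OF i, of U] by (auto simp: F_def)
        thus ?thesis using C X(1)[OF i] PN(1) by (fastforce simp: in_arcs_def out_arcs_def)
      next
        case True
        hence "V - U \<in> G" using U ends unfolding G_def in_arcs_def by blast
        hence "in_arcs (Y i) tail head (V - U) \<noteq> {}" using Y(3)[OF i] by blast
        thus ?thesis using C Y(1)[OF i] PN(2) ends by (fastforce simp: in_arcs_def out_arcs_def)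
      qed
    qed
    thus "is_dijoin V A tail head (X i \<union> Y i)"
      using X(1)[OF i] Y(1)[OF i] PN(1,2) by (auto simp: is_dijoin_def)
  qed
qed

theorem theorem3:
  fixes V :: "'v set" and A :: "'a set" and tail head :: "'a \<Rightarrow> 'v"
    and \<tau> :: nat and k :: real
  assumes "digraph V A tail head"
    and "min_dicut_size V A tail head \<tau>"
    and "k \<in> \<rat>" and "k \<ge> 2"
    and "has_nz_circular_flow V A tail head k"
  shows "\<exists>J :: nat \<Rightarrow> 'a set.
           (\<forall>i < nat \<lfloor>real \<tau> / k\<rfloor>. is_dijoin V A tail head (J i)) \<and>
           (\<forall>i < nat \<lfloor>real \<tau> / k\<rfloor>. \<forall>j < nat \<lfloor>real \<tau> / k\<rfloor>. i \<noteq> j \<longrightarrow> J i \<inter> J j = {})"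
proof -
  define t where "t = nat \<lfloor>real \<tau> / k\<rfloor>"
  have "real t \<le> real \<tau> / k" unfolding t_def using assms(4) by simp
  hence t: "real t * k \<le> \<tau>" using assms(4) by (simp add: field_simps)
  obtain fwd f where flow: "nz_circular_flow V A tail head k fwd f"
    using assms(5) by (auto simp: has_nz_circular_flow_def)
  \<comment> \<open>Cancel \<open>k\<close> in the chain
    \<open>t * k \<le> \<tau> \<le> card C \<le> k * n\<close>.\<close>
  have bound: "t \<le> n" if "real (card C) \<le> k * n" "is_dicut V A tail head C" for C n
  proof -
    have "real t * k \<le> real n * k"
      using t that(1) min_dicut_size_le[OF assms(1,2) that(2)] by (simp add: mult.commute)
    thus ?thesis using assms(4) by simp
  qed
  have "t \<le> card (C \<inter> {a\<in>A. fwd a}) \<and> t \<le> card (C \<inter> {a\<in>A. \<not> fwd a})"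
    if C: "is_dicut V A tail head C" for C
  proof -
    obtain U where U: "U \<subseteq> V" "in_arcs A tail head U = {}" "C = out_arcs A tail head U"
      using C by (auto simp: is_dicut_def)
    have "C \<inter> {a\<in>A. fwd a} = {a\<in>C. fwd a}" "C \<inter> {a\<in>A. \<not> fwd a} = {a\<in>C. \<not> fwd a}"
      using U(3) by (auto simp: out_arcs_def)
    thus ?thesis using dicut_balanced[OF assms(1) flow U(1,2)] bound C U(3) by simp
  qed
  then obtain J where "\<And>i. i < t \<Longrightarrow> is_dijoin V A tail head (J i)" "disjoint_family_on J {..<t}"
    using dijoins_from_two_classes[OF assms(1), of "{a\<in>A. fwd a}" "{a\<in>A. \<not> fwd a}" t] by blast
  thus ?thesis unfolding t_def disjoint_family_on_def by blast
qed

end
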